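(* Let $(X,d)$ be a complete metric space and let $T:X\to\mathcal{CB}(X)$ be a multi-valued mapping such that $$\mathcal{H}(Tx,Ty)\leq \eta(d(x,y))\,d(x,y)$$ for all $x,y\in X$, where $\eta:[0,+\infty)\to[0,1)$ is a lower semicontinuous and non-decreasing mapping. Then $T$ has a fixed point.
   Context: $\mathcal{CB}(X)$ denotes the family of all nonempty closed and bounded subsets of $X$, and $\mathcal{H}$ is the Hausdorff metric on $\mathcal{CB}(X)$ induced by $d$: $\mathcal{H}(A,B)=\max\{\sup_{x\in B}d(x,A),\ \sup_{x\in A}d(x,B)\}$, where $d(x,A)=\inf_{a\in A}d(x,a)$. A fixed point of $T:X\to\mathcal{CB}(X)$ is a point $v\in X$ with $v\in Tv$. *)

theory Defs
  imports "HOL-Analysis.Analysis"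
begin

definition CB :: "'a::metric_space set set" where
  "CB = {A. A \<noteq> {} \<and> closed A \<and> bounded A}"

text \<open>
  Meaningful for arguments in \<^const>\<open>CB\<close>: there both suprema range over nonempty sets of
  reals that are bounded above, and \<^const>\<open>infdist\<close> is the infimum of the distances.
\<close>

definition hausdorff_dist :: "'a::metric_space set \<Rightarrow> 'a set \<Rightarrow> real" where
  "hausdorff_dist A B = max (SUP x\<in>B. infdist x A) (SUP x\<in>A. infdist x B)"

text \<open>
  Lower semicontinuity relative to the subspace \<open>S\<close>. The filter \<^term>\<open>at x within S\<close> leaves
  out \<open>x\<close> itself, where the inequality holds anyway.
\<close>

definition lower_semicontinuous_on :: "'a::topological_space set \<Rightarrow> ('a \<Rightarrow> real) \<Rightarrow> bool" where
  "lower_semicontinuous_on S f \<longleftrightarrow>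
     (\<forall>x\<in>S. \<forall>a < f x. \<forall>\<^sub>F y in at x within S. a < f y)"

end

theory Submission
  imports Defs
begin

text \<open>
  Because \<open>\<eta>\<close> is non-decreasing, \<open>T\<close> contracts with the single rate \<open>\<eta> d < 1\<close> between
  any two points at distance at most \<open>d\<close>. Start with \<open>x\<^sub>0\<close> and \<open>x\<^sub>1 \<in> T x\<^sub>0\<close>, and take
  \<open>d\<close> to be their distance. If consecutive points of the orbit stay within \<open>d\<close> of each other,
  Nadler's argument applies with the constant rate \<open>\<eta> d\<close>; and they do stay within \<open>d\<close>, since
  no step is longer than the one before. The steps therefore decay geometrically, the orbit
  converges, and its limit has distance zero from its own closed image.

  An approximate nearest point must be taken in place of a nearest one, which need not exist in a
  closed bounded set. This is why the steps shrink by a factor \<open>k\<close> strictly between \<open>\<eta> d\<close>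
  and \<open>1\<close>.
\<close>

lemma infdist_le_hausdorff_dist:
  assumes "A \<in> CB" and "B \<in> CB" and "x \<in> A"
  shows "infdist x B \<le> hausdorff_dist A B"
proof -
  from assms obtain b where b: "b \<in> B"
    by (auto simp: CB_def)
  from assms obtain e where e: "\<And>y. y \<in> A \<Longrightarrow> dist b y \<le> e"
    by (auto simp: CB_def bounded_any_center[where a = b])
  have "bdd_above ((\<lambda>y. infdist y B) ` A)"
    by (rule bdd_aboveI2[where M = e]) (metis b e infdist_le2 dist_commute)
  then have "infdist x B \<le> (SUP y\<in>A. infdist y B)"
    using assms(3) by (rule cSUP_upper[rotated])
  then show ?thesis
    by (simp add: hausdorff_dist_def)
qed

lemma exists_dist_less_of_infdist_less:
  assumes "A \<noteq> {}" and "infdist x A < e"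
  obtains a where "a \<in> A" and "dist x a < e"
  using assms cInf_lessD[of "dist x ` A" e] by (auto simp: infdist_def)

lemma Cauchy_of_geometric_steps:
  fixes x :: "nat \<Rightarrow> 'a::metric_space"
  assumes k: "0 \<le> k" "k < 1"
    and steps: "\<And>n. dist (x (Suc n)) (x (Suc (Suc n))) \<le> k * dist (x n) (x (Suc n))"
  shows "Cauchy x"
proof -
  define d where "d = dist (x 0) (x 1)"
  have step: "dist (x n) (x (Suc n)) \<le> k ^ n * d" for n
  proof (induction n)
    case 0
    then show ?case by (simp add: d_def)
  next
    case (Suc n)
    then show ?case
      using steps[of n] mult_left_mono[OF Suc k(1)] by (simp add: mult.assoc)
  qed
  \<comment> \<open>The partial sums of the geometric series are written without division, so that the
    estimate passes through the induction.\<close>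
  have tail: "(1 - k) * dist (x n) (x (n + m)) \<le> k ^ n * d * (1 - k ^ m)" for n m
  proof (induction m)
    case 0
    then show ?case by simp
  next
    case (Suc m)
    have "(1 - k) * dist (x n) (x (n + Suc m))
        \<le> (1 - k) * (dist (x n) (x (n + m)) + dist (x (n + m)) (x (Suc (n + m))))"
      using k by (intro mult_left_mono) (auto intro: dist_triangle)
    also have "\<dots> \<le> k ^ n * d * (1 - k ^ m) + (1 - k) * (k ^ (n + m) * d)"
      unfolding distrib_left using k by (intro add_mono Suc mult_left_mono step) auto
    also have "\<dots> = k ^ n * d * (1 - k ^ Suc m)"
      by (simp add: algebra_simps power_add)
    finally show ?case .
  qed
  have bound: "dist (x n) (x (n + m)) \<le> k ^ n * (d / (1 - k))" for n m
  proof -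
    have "(1 - k) * dist (x n) (x (n + m)) \<le> k ^ n * d"
      using tail[of n m] k mult_left_mono[of "1 - k ^ m" 1 "k ^ n * d"]
      by (auto simp: d_def)
    then show ?thesis
      using k by (simp add: field_simps)
  qed
  have "(\<lambda>n. k ^ n * (d / (1 - k))) \<longlonglongrightarrow> 0"
    using k by (intro tendsto_mult_left_zero LIMSEQ_power_zero) auto
  then have small: "\<exists>N. \<forall>n\<ge>N. k ^ n * (d / (1 - k)) < e" if "e > 0" for e
    using that by (auto dest: order_tendstoD(2) simp: eventually_sequentially)
  show ?thesis
  proof (rule metric_CauchyI)
    fix e :: real
    assume "e > 0"
    with small[of "e / 2"] obtain N where N: "k ^ N * (d / (1 - k)) < e / 2"
      by auto
    have "dist (x N) (x m) < e / 2" if "m \<ge> N" for m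
      using le_less_trans[OF bound[of N "m - N"] N] that by simp
    then have "dist (x m) (x n) < e" if "m \<ge> N" "n \<ge> N" for m n
      using that by (metis dist_commute dist_triangle_half_l)
    then show "\<exists>M. \<forall>m\<ge>M. \<forall>n\<ge>M. dist (x m) (x n) < e"
      by blast
  qed
qed

text \<open>
  In \<open>infdist v (T v) \<le> dist v (x (Suc n)) + infdist (x (Suc n)) (T v)\<close> the last term is at
  most \<open>dist (x n) v\<close>, because \<open>x (Suc n) \<in> T (x n)\<close> and \<open>T\<close> is non-expansive; both
  terms vanish in the limit.
\<close>

lemma limit_of_orbit_is_fixed_point:
  assumes CB: "\<And>x. T x \<in> CB"
    and nonexp: "\<And>x y. hausdorff_dist (T x) (T y) \<le> dist x y"
    and orbit: "\<And>n. x (Suc n) \<in> T (x n)"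
    and lim: "x \<longlonglongrightarrow> v"
  shows "v \<in> T v"
proof -
  have "infdist v (T v) \<le> dist v (x (Suc n)) + dist (x n) v" for n
    using infdist_triangle[of v "T v" "x (Suc n)"]
      infdist_le_hausdorff_dist[OF CB CB orbit[of n], of v] nonexp[of "x n" v]
    by linarith
  moreover have "(\<lambda>n. dist v (x (Suc n)) + dist (x n) v) \<longlonglongrightarrow> dist v v + dist v v"
    by (intro tendsto_intros lim LIMSEQ_Suc)
  ultimately have "infdist v (T v) \<le> 0"
    by (intro LIMSEQ_le_const[where X = "\<lambda>n. dist v (x (Suc n)) + dist (x n) v"]) auto
  then have "infdist v (T v) = 0"
    using infdist_nonneg[of v "T v"] by linarith
  then show ?thesis
    using CB[of v] in_closed_iff_infdist_zero[of "T v" v] by (auto simp: CB_def)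
qed

theorem corollary2p4:
  fixes T :: "'a::complete_space \<Rightarrow> 'a set"
    and \<eta> :: "real \<Rightarrow> real"
  assumes "\<And>x. T x \<in> CB"
    and "\<eta> \<in> {0..} \<rightarrow> {0..<1}"
    and "lower_semicontinuous_on {0..} \<eta>"
    and "mono_on {0..} \<eta>"
    and "\<And>x y. hausdorff_dist (T x) (T y) \<le> \<eta> (dist x y) * dist x y"
  shows "\<exists>v. v \<in> T v"
proof -
  have \<eta>: "0 \<le> \<eta> t" "\<eta> t < 1" if "t \<ge> 0" for t
    using assms(2) that by (auto simp: Pi_iff)
  have nonempty: "T x \<noteq> {}" for x
    using assms(1)[of x] by (simp add: CB_def)
  obtain x0 x1 where x1: "x1 \<in> T x0"
    using nonempty by blast
  define d where "d = dist x0 x1"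
  obtain k where k: "\<eta> d < k" "k < 1"
    using dense[OF \<eta>(2)[of d]] by (auto simp: d_def)
  have k0: "0 \<le> k"
    using \<eta>(1)[of d] k by (auto simp: d_def)

  have next_point: "\<exists>c. c \<in> T b \<and> dist b c \<le> k * dist a b"
    if b: "b \<in> T a" and le: "dist a b \<le> d" for a b
  proof (cases "a = b")
    \<comment> \<open>A step of length zero leaves no room for an approximate nearest point, but then the
      orbit has already reached a fixed point and may stay there.\<close>
    case True
    then show ?thesis
      using b by auto
  next
    case False
    have "infdist b (T b) \<le> \<eta> (dist a b) * dist a b"
      using infdist_le_hausdorff_dist[OF assms(1) assms(1) b, of b] assms(5)[of a b] by linarith
    also have "\<dots> \<le> \<eta> d * dist a b"
      using le by (intro mult_right_mono mono_onD[OF assms(4)]) (auto simp: d_def)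
    also have "\<dots> < k * dist a b"
      using False k by simp
    finally obtain c where "c \<in> T b" "dist b c < k * dist a b"
      using exists_dist_less_of_infdist_less[OF nonempty] by blast
    then show ?thesis
      by (auto intro: less_imp_le)
  qed

  \<comment> \<open>The bound on a step refers to the step before, so the recursion runs on pairs of
    consecutive points.\<close>
  have "\<exists>p. \<forall>n. (snd (p n) \<in> T (fst (p n)) \<and> dist (fst (p n)) (snd (p n)) \<le> d)
      \<and> (fst (p (Suc n)) = snd (p n)
        \<and> dist (fst (p (Suc n))) (snd (p (Suc n))) \<le> k * dist (fst (p n)) (snd (p n)))"
  proof (rule dependent_nat_choice)
    show "\<exists>q. snd q \<in> T (fst q) \<and> dist (fst q) (snd q) \<le> d"
      using x1 by (intro exI[of _ "(x0, x1)"]) (simp add: d_def)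
  next
    fix q :: "'a \<times> 'a"
    assume q: "snd q \<in> T (fst q) \<and> dist (fst q) (snd q) \<le> d"
    then obtain c where c: "c \<in> T (snd q)" "dist (snd q) c \<le> k * dist (fst q) (snd q)"
      using next_point by blast
    moreover have "k * dist (fst q) (snd q) \<le> dist (fst q) (snd q)"
      using k k0 by (intro mult_left_le_one_le) auto
    ultimately have "dist (snd q) c \<le> d"
      using q by linarith
    with c show "\<exists>r. (snd r \<in> T (fst r) \<and> dist (fst r) (snd r) \<le> d)
        \<and> (fst r = snd q \<and> dist (fst r) (snd r) \<le> k * dist (fst q) (snd q))"
      by (intro exI[of _ "(snd q, c)"]) simp
  qed
  then obtain p where orbit_pairs: "\<And>n. snd (p n) \<in> T (fst (p n))"
    "\<And>n. fst (p (Suc n)) = snd (p n)"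
    "\<And>n. dist (fst (p (Suc n))) (snd (p (Suc n))) \<le> k * dist (fst (p n)) (snd (p n))"
    by blast
  define x where "x n = fst (p n)" for n
  have orbit: "x (Suc n) \<in> T (x n)" for n
    by (simp add: x_def orbit_pairs)
  have "dist (x (Suc n)) (x (Suc (Suc n))) \<le> k * dist (x n) (x (Suc n))" for n
    using orbit_pairs(3)[of n] by (simp add: x_def orbit_pairs(2))
  then have "Cauchy x"
    by (rule Cauchy_of_geometric_steps[OF k0 k(2)])
  then obtain v where "x \<longlonglongrightarrow> v"
    using Cauchy_convergent_iff convergent_def by blast
  moreover have "hausdorff_dist (T x) (T y) \<le> dist x y" for x y
  proof -
    have "\<eta> (dist x y) * dist x y \<le> dist x y"
      using \<eta>[of "dist x y"] by (intro mult_left_le_one_le) auto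
    then show ?thesis
      using assms(5)[of x y] by linarith
  qed
  ultimately show ?thesis
    using limit_of_orbit_is_fixed_point[where T = T and x = x] assms(1) orbit by blast
qed

end
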